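(* For $a\in(1/15,\infty)$ and $n\in\mathbb{N}$ let $$l_n(a)=H_n-\frac{1}{90a^2+2}\ln\left(n^2+n+\frac{3a+1}{3}\right)-\frac{45a^2}{90a^2+2}\ln\left(n^2+n+\frac{15a-1}{45a}\right).$$ Then the sequence $(l_n(a))_{n\in\mathbb{N}}$ is strictly increasing and concave if $a\ge a_1=\frac{40+3\sqrt{205}}{105}$, and it is decreasing and convex if $a\in(1/15,a_0'')$, where $a_0''\approx 0.4321803644583305$.
   Context: $\mathbb{N}=\{1,2,3,\ldots\}$ and $H_n=\sum_{k=1}^n\frac1k$. A sequence $(s_n)$ is concave (resp. convex) if $s_{n}+s_{n+2}\le 2s_{n+1}$ (resp. $\ge$) for all $n$. The number $a_0''$ is the unique root on $(1/15,\infty)$ of the equation (in $a$) $\psi''(1)-\mathcal{L}_{xx}(0,a)=0$, where $\psi=\Gamma'/\Gamma$ is the digamma function, $\mathcal{L}_{xx}=\partial^2\mathcal{L}/\partial x^2$, and for $x\ge0$, $a>1/15$, $$\mathcal{L}(x,a)=\frac{1}{90a^{2}+2}\ln\left(x^{2}+x+\frac{3a+1}{3}\right)+\frac{45a^{2}}{90a^{2}+2}\ln\left(x^{2}+x+\frac{15a-1}{45a}\right).$$ *)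

theory Defs
  imports "HOL-Analysis.Analysis"
begin

definition calL :: "real \<Rightarrow> real \<Rightarrow> real" where
  "calL x a = 1 / (90 * a^2 + 2) * ln (x^2 + x + (3 * a + 1) / 3)
            + 45 * a^2 / (90 * a^2 + 2) * ln (x^2 + x + (15 * a - 1) / (45 * a))"

text \<open>
  The two-sided derivative is meaningful at \<open>x = 0\<close>: for \<open>a > 1/15\<close> both arguments of \<open>ln\<close>
  in \<open>calL\<close> are positive on a neighbourhood of every \<open>x \<ge> 0\<close>, so it agrees with the
  one-sided derivative of the restriction to \<open>x \<ge> 0\<close>.
\<close>
definition calL_xx :: "real \<Rightarrow> real \<Rightarrow> real" where
  "calL_xx x a = (deriv ^^ 2) (\<lambda>t. calL t a) x"

definition a0_root :: "real \<Rightarrow> bool" where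
  "a0_root a \<longleftrightarrow> a > 1 / 15 \<and> (deriv ^^ 2) (Digamma :: real \<Rightarrow> real) 1 - calL_xx 0 a = 0"

definition a0'' :: real where
  "a0'' = (THE a. a0_root a)"

definition a1 :: real where
  "a1 = (40 + 3 * sqrt 205) / 105"

definition l :: "real \<Rightarrow> nat \<Rightarrow> real" where
  "l a n = harm n
     - 1 / (90 * a^2 + 2) * ln ((real n)^2 + real n + (3 * a + 1) / 3)
     - 45 * a^2 / (90 * a^2 + 2) * ln ((real n)^2 + real n + (15 * a - 1) / (45 * a))"

text \<open>Sequences are indexed by \<open>1, 2, 3, \<dots>\<close>; the value at \<open>0\<close> is irrelevant.\<close>
definition concave_seq :: "(nat \<Rightarrow> real) \<Rightarrow> bool" where
  "concave_seq s \<longleftrightarrow> (\<forall>n\<ge>1. s n + s (n + 2) \<le> 2 * s (n + 1))"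

definition convex_seq :: "(nat \<Rightarrow> real) \<Rightarrow> bool" where
  "convex_seq s \<longleftrightarrow> (\<forall>n\<ge>1. s n + s (n + 2) \<ge> 2 * s (n + 1))"

end

theory Submission
  imports Defs "HOL-Real_Asymp.Real_Asymp"
begin

text \<open>
  Both halves of the theorem are statements about the increments of \<open>l a\<close>. With \<open>x = n + 1\<close> the
  increment \<open>l a (n + 1) - l a n\<close> is an elementary function \<open>incr a x\<close>: by
  \<open>n\<^sup>2 + n = x\<^sup>2 - x\<close> it is \<open>1 / x\<close> minus a weighted sum of differences
  \<open>ln (x\<^sup>2 + x + c) - ln (x\<^sup>2 - x + c)\<close>. Its derivative is rational in \<open>t = x\<^sup>2\<close>, and the weights and
  shifts of \<open>l\<close> are such that the coefficients of \<open>t\<^sup>4\<close>, \<open>t\<^sup>3\<close> and \<open>t\<^sup>2\<close> in the numerator cancel.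
  Up to a positive factor the numerator is
  \<open>9 a (7 + 240 a - 315 a\<^sup>2) t - ((3 a + 1) (15 a - 1))\<^sup>2\<close> (lemma \<open>incr_has_derivative\<close>).
  The number \<open>a1\<close> is the positive root of \<open>7 + 240 a - 315 a\<^sup>2\<close>, so for \<open>a \<ge> a1\<close> the numerator is
  negative and the increments decrease strictly: \<open>l a\<close> is concave. If \<open>a\<close> is below \<open>11/25\<close>, the
  linear term dominates as soon as \<open>t \<ge> 4\<close>, the increments increase, and \<open>l a\<close> is convex. Since the
  increments tend to \<open>0\<close>, they are positive in the first case and negative in the second, which
  gives the monotonicity.

  What is left is to locate \<open>a0''\<close>. The equation that defines it reads
  \<open>calL_xx 0 a = - 2 \<zeta>(3)\<close>. Its left side is an explicit rational function \<open>curv0\<close> of \<open>a\<close>, strictly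
  increasing on \<open>(1/15, \<infinity>)\<close>, so there is at most one root, and evaluating \<open>curv0\<close> at the two
  ends of the claimed interval gives existence and the numerical bound. The root is only about
  half the permitted error away from the given decimal, hence \<open>\<zeta>(3)\<close> is needed to an absolute
  accuracy of about \<open>5 / 10\<^sup>1\<^sup>7\<close>; summation of the first twenty terms and a rational estimate of the
  remainder achieve this (lemma \<open>zeta3_bounds\<close>).
\<close>

section \<open>The value of zeta(3)\<close>

lemma suminf_ge_partial_plus_tail:
  fixes f T :: "nat \<Rightarrow> real"
  assumes "summable f" and "T \<longlonglongrightarrow> 0" and "\<And>k. k \<ge> N \<Longrightarrow> T k - T (Suc k) \<le> f k"
  shows "(\<Sum>k<N. f k) + T N \<le> suminf f"
proof -
  have "(\<lambda>k. T (k + N)) \<longlonglongrightarrow> 0"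
    using assms(2) by (rule LIMSEQ_ignore_initial_segment)
  then have "(\<lambda>k. T (k + N) - T (Suc k + N)) sums (T (0 + N) - 0)"
    by (rule telescope_sums')
  moreover have "(\<lambda>k. f (k + N)) sums (suminf f - (\<Sum>k<N. f k))"
    using assms(1) by (simp add: sums_iff_shift summable_sums)
  ultimately have "T (0 + N) - 0 \<le> suminf f - (\<Sum>k<N. f k)"
    by (rule sums_le[rotated]) (use assms(3) in auto)
  then show ?thesis by simp
qed

lemma suminf_le_partial_plus_tail:
  fixes f T :: "nat \<Rightarrow> real"
  assumes "summable f" and "T \<longlonglongrightarrow> 0" and "\<And>k. k \<ge> N \<Longrightarrow> f k \<le> T k - T (Suc k)"
  shows "suminf f \<le> (\<Sum>k<N. f k) + T N"
proof -
  have "T k - T (Suc k) \<ge> f k" if "k \<ge> N" for k using assms(3) that by simp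
  then have "(\<Sum>k<N. - f k) + (- T N) \<le> suminf (\<lambda>k. - f k)"
    using assms tendsto_minus[OF assms(2)]
    by (intro suminf_ge_partial_plus_tail summable_minus) (auto simp: algebra_simps)
  then show ?thesis using assms(1) by (simp add: suminf_minus sum_negf)
qed

text \<open>
  The remainder \<open>\<Sum>j>k. 1 / j\<^sup>3\<close> has an asymptotic expansion in powers of \<open>1 / w\<close> with \<open>w = k (k + 1)\<close>,
  beginning with \<open>1 / (2 w) - 1 / (4 w\<^sup>2)\<close>. The two functions below are Pade approximants of this
  expansion (with numerators and denominators multiplied by \<open>120\<close> and \<open>60\<close>); the constant
  term of the denominator is forced to be \<open>0\<close> in the second one, which makes it err on the other
  side. Being Pade approximants, they nearly telescope to \<open>1 / k\<^sup>3\<close>: the defect has a single monomial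
  as numerator, so its sign is visible.
\<close>

definition tail_lo :: "nat \<Rightarrow> real" where
  "tail_lo k = (let w = real k * (real k + 1) in
     (60*w^2 + 300*w + 251) / (120*w^3 + 660*w^2 + 792*w + 216))"

definition tail_hi :: "nat \<Rightarrow> real" where
  "tail_hi k = (let w = real k * (real k + 1) in
     (30*w^2 + 69*w + 4) / (60*w^3 + 168*w^2 + 72*w))"

lemma tail_lo_tendsto: "tail_lo \<longlonglongrightarrow> 0"
  unfolding tail_lo_def Let_def by real_asymp

lemma tail_hi_tendsto: "tail_hi \<longlonglongrightarrow> 0"
  unfolding tail_hi_def Let_def by real_asymp

lemma tail_lo_step: "tail_lo k - tail_lo (Suc k) \<le> 1 / real (Suc k) ^ 3"
proof -
  define x where "x = real k + 1"
  have x: "x \<ge> 1" by (simp add: x_def)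
  define v w where "v = (x - 1) * x" and "w = x * (x + 1)"
  define p q :: "real \<Rightarrow> real" where "p = (\<lambda>w. 60*w^2 + 300*w + 251)"
    and "q = (\<lambda>w. 120*w^3 + 660*w^2 + 792*w + 216)"
  have "v \<ge> 0" "w \<ge> 0" using x by (auto simp: v_def w_def)
  then have pos: "q v > 0" "q w > 0"
    by (auto simp: q_def intro!: add_nonneg_pos add_nonneg_nonneg)
  have "x^3 * (p v * q w - p w * q v) = q v * q w - 46656"
    unfolding p_def q_def v_def w_def by algebra
  then have "x^3 * (p v * q w - p w * q v) \<le> q v * q w" by simp
  then have "p v / q v - p w / q w \<le> 1 / x^3"
    using pos x by (simp add: divide_simps mult_ac)
  moreover have "tail_lo k = p v / q v" "tail_lo (Suc k) = p w / q w"
    by (simp_all add: tail_lo_def Let_def p_def q_def v_def w_def x_def mult_ac add_ac)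
  ultimately show ?thesis by (simp add: x_def add_ac)
qed

lemma tail_hi_step:
  assumes "k \<ge> 1"
  shows "1 / real (Suc k) ^ 3 \<le> tail_hi k - tail_hi (Suc k)"
proof -
  define x where "x = real k + 1"
  have x: "x \<ge> 2" using assms by (simp add: x_def)
  define v w where "v = (x - 1) * x" and "w = x * (x + 1)"
  define p q :: "real \<Rightarrow> real" where "p = (\<lambda>w. 30*w^2 + 69*w + 4)"
    and "q = (\<lambda>w. 60*w^3 + 168*w^2 + 72*w)"
  have "v > 0" "w > 0" using x by (auto simp: v_def w_def)
  then have pos: "q v > 0" "q w > 0"
    by (auto simp: q_def intro!: add_pos_pos)
  have "x^3 * (p v * q w - p w * q v) = q v * q w + 5184 * x^2"
    unfolding p_def q_def v_def w_def by algebra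
  then have "q v * q w \<le> x^3 * (p v * q w - p w * q v)" by simp
  then have "1 / x^3 \<le> p v / q v - p w / q w"
    using pos x by (simp add: divide_simps mult_ac)
  moreover have "tail_hi k = p v / q v" "tail_hi (Suc k) = p w / q w"
    by (simp_all add: tail_hi_def Let_def p_def q_def v_def w_def x_def mult_ac add_ac)
  ultimately show ?thesis by (simp add: x_def add_ac)
qed

abbreviation zeta3 :: real where "zeta3 \<equiv> (\<Sum>k. 1 / real (Suc k) ^ 3)"

lemma summable_zeta3: "summable (\<lambda>k. 1 / real (Suc k) ^ 3)"
proof -
  have "summable (\<lambda>k. inverse (real (Suc k) ^ 3))"
    using inverse_power_summable[of 3, where ?'a = real] by (subst summable_Suc_iff) simp
  then show ?thesis by (simp add: inverse_eq_divide)
qed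

lemma zeta3_bounds:
  "1202056903159594285 / 10^18 \<le> zeta3" "zeta3 \<le> 1202056903159594309 / 10^18"
proof -
  have "(\<Sum>k<20. 1 / real (Suc k) ^ 3) + tail_lo 20 \<le> zeta3"
    by (intro suminf_ge_partial_plus_tail summable_zeta3 tail_lo_tendsto tail_lo_step)
  moreover have "zeta3 \<le> (\<Sum>k<20. 1 / real (Suc k) ^ 3) + tail_hi 20"
    by (intro suminf_le_partial_plus_tail summable_zeta3 tail_hi_tendsto tail_hi_step) auto
  ultimately show "1202056903159594285 / 10^18 \<le> zeta3" "zeta3 \<le> 1202056903159594309 / 10^18"
    by (simp_all add: tail_lo_def tail_hi_def Let_def eval_nat_numeral lessThan_Suc)
qed

lemma deriv2_Digamma_1: "(deriv ^^ 2) (Digamma :: real \<Rightarrow> real) 1 = - 2 * zeta3"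
proof -
  have "deriv Digamma x = Polygamma 1 x" if "x > 0" for x :: real
    by (rule DERIV_imp_deriv, rule DERIV_cong, rule has_field_derivative_Polygamma)
      (use that in \<open>auto elim: nonpos_Ints_cases\<close>)
  then have "eventually (\<lambda>x::real. deriv Digamma x = Polygamma 1 x) (nhds 1)"
    by (intro eventually_mono[OF eventually_nhds_in_open[of "{0<..}"]]) auto
  then have "deriv (deriv Digamma) (1::real) = deriv (Polygamma 1) 1"
    by (rule deriv_cong_ev) simp
  also have "\<dots> = Polygamma (Suc 1) 1"
    by (rule DERIV_imp_deriv, rule has_field_derivative_Polygamma) auto
  also have "\<dots> = - 2 * zeta3"
    by (simp add: Polygamma_def inverse_eq_divide eval_nat_numeral mult_ac)
  finally show ?thesis by (simp add: eval_nat_numeral)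
qed

section \<open>The curvature of calL at the origin\<close>

lemma calL_xx_0:
  assumes "a > 1/15"
  defines "c \<equiv> (3*a + 1) / 3" and "d \<equiv> (15*a - 1) / (45*a)"
  shows "calL_xx 0 a = 1 / (90*a^2 + 2) * ((2*c - 1) / c^2) + 45*a^2 / (90*a^2 + 2) * ((2*d - 1) / d^2)"
proof -
  have cd: "c > 0" "d > 0" using assms by (auto simp: field_simps)
  define A B where "A = 1 / (90*a^2 + 2)" and "B = 45*a^2 / (90*a^2 + 2)"
  define f' where "f' = (\<lambda>t. A * ((2*t + 1) / (t^2 + t + c)) + B * ((2*t + 1) / (t^2 + t + d)))"
  let ?S = "{t::real. 0 < t^2 + t + c} \<inter> {t. 0 < t^2 + t + d}"
  have "open ?S" by (intro open_Int open_Collect_less continuous_intros)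
  have "deriv (\<lambda>t. calL t a) t = f' t" if "t \<in> ?S" for t
    unfolding calL_def f'_def A_def[symmetric] B_def[symmetric] c_def[symmetric] d_def[symmetric]
    by (rule DERIV_imp_deriv) (use that in \<open>auto intro!: derivative_eq_intros simp: divide_simps\<close>)
  moreover have "eventually (\<lambda>t. t \<in> ?S) (nhds 0)"
    using \<open>open ?S\<close> cd by (intro eventually_nhds_in_open) auto
  ultimately have "eventually (\<lambda>t. deriv (\<lambda>t. calL t a) t = f' t) (nhds 0)"
    by (auto elim: eventually_mono)
  then have "deriv (deriv (\<lambda>t. calL t a)) 0 = deriv f' 0"
    by (rule deriv_cong_ev) simp
  also have "\<dots> = A * ((2*c - 1) / c^2) + B * ((2*d - 1) / d^2)"
    unfolding f'_def
    by (rule DERIV_imp_deriv)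
      (use cd in \<open>auto intro!: derivative_eq_intros simp: power2_eq_square algebra_simps\<close>)
  finally show ?thesis by (simp add: calL_xx_def eval_nat_numeral A_def B_def)
qed

text \<open>
  The expression for \<open>calL_xx 0 a\<close> over a common denominator, so that monotonicity is a matter of
  one quotient rule.
\<close>

definition curv0 :: "real \<Rightarrow> real" where
  "curv0 a = (3*(6*a - 1)*(15*a - 1)^2 - 2025*a^3*(15*a + 2)*(3*a + 1)^2)
     / ((90*a^2 + 2) * (3*a + 1)^2 * (15*a - 1)^2)"

lemma calL_xx_0_eq_curv0:
  assumes "a > 1/15"
  shows "calL_xx 0 a = curv0 a"
proof -
  define u w r where "u = 3*a + 1" and "w = 15*a - 1" and "r = 90*a^2 + 2"
  have pos: "a > 0" "u > 0" "w > 0" "r > 0"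
    using assms by (auto simp: u_def w_def r_def intro: add_nonneg_pos)
  have 1: "(2*(u/3) - 1) / (u/3)^2 = 3*(6*a - 1) / u^2"
    using pos by (simp add: field_simps power2_eq_square) (simp add: u_def algebra_simps)
  have 2: "(2*(w/(45*a)) - 1) / (w/(45*a))^2 = - (45*a*(15*a + 2) / w^2)"
    using pos by (simp add: field_simps power2_eq_square) (simp add: w_def algebra_simps)
  have "1 / r * (3*(6*a - 1) / u^2) + 45*a^2 / r * (- (45*a*(15*a + 2) / w^2))
      = (3*(6*a - 1)*w^2 - 2025*a^3*(15*a + 2)*u^2) / (r * u^2 * w^2)"
    using pos by (simp add: field_simps power2_eq_square power3_eq_cube)
  then show ?thesis
    unfolding calL_xx_0[OF assms] curv0_def u_def[symmetric] w_def[symmetric] r_def[symmetric] 1 2 .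
qed

text \<open>
  The factor \<open>(3 a + 1) (15 a - 1)\<close> of \<open>N' M - N M'\<close> comes from the squares in the denominator. In
  the remaining factor the only negative coefficients, \<open>- 8\<close> and \<open>- 720\<close>, are absorbed by the terms
  \<open>312 a\<close> and \<open>42120 a\<^sup>3\<close> because \<open>a > 1/15\<close>.
\<close>

lemma curv0_has_positive_derivative:
  assumes "a > 1/15"
  shows "\<exists>y. (curv0 has_real_derivative y) (at a) \<and> y > 0"
proof -
  define N M where "N = 3*(6*a - 1)*(15*a - 1)^2 - 2025*a^3*(15*a + 2)*(3*a + 1)^2"
    and "M = (90*a^2 + 2) * (3*a + 1)^2 * (15*a - 1)^2"
  define N' where "N' = 18*(15*a - 1)^2 + 90*(6*a - 1)*(15*a - 1)
      - (6075*a^2*(15*a + 2)*(3*a + 1)^2 + 30375*a^3*(3*a + 1)^2 + 12150*a^3*(15*a + 2)*(3*a + 1))"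
  define M' where "M' = 180*a*(3*a + 1)^2*(15*a - 1)^2 + 6*(90*a^2 + 2)*(3*a + 1)*(15*a - 1)^2
      + 30*(90*a^2 + 2)*(3*a + 1)^2*(15*a - 1)"
  have a: "a > 0" using assms by simp
  have "M > 0" using assms a by (auto simp: M_def intro!: mult_pos_pos add_nonneg_pos)
  have N: "((\<lambda>a. 3*(6*a - 1)*(15*a - 1)^2 - 2025*a^3*(15*a + 2)*(3*a + 1)^2)
      has_real_derivative N') (at a)"
    unfolding N'_def by (rule derivative_eq_intros refl)+ (simp add: algebra_simps power2_eq_square power3_eq_cube)
  have M: "((\<lambda>a. (90*a^2 + 2) * (3*a + 1)^2 * (15*a - 1)^2) has_real_derivative M') (at a)"
    unfolding M'_def by (rule derivative_eq_intros refl)+ (simp add: algebra_simps power2_eq_square power3_eq_cube)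
  have "(curv0 has_real_derivative ((N' * M - N * M') / (M * M))) (at a)"
    unfolding curv0_def N_def M_def
    by (rule DERIV_divide[OF N M]) (use \<open>M > 0\<close> in \<open>unfold M_def, linarith\<close>)
  moreover have "N' * M - N * M' = 9 * ((3*a + 1) * (15*a - 1)) *
     ((312*a - 8) + a^2*(42120*a - 720) + 1895400*a^5 + 1458000*a^6 + 28431000*a^7 + 32805000*a^8)"
    unfolding N_def M_def N'_def M'_def by algebra
  moreover have "\<dots> > 0"
    using assms a by (intro mult_pos_pos add_pos_pos) auto
  ultimately show ?thesis using \<open>M > 0\<close> by auto
qed

lemma curv0_strict_mono:
  assumes "1/15 < a" "a < b"
  shows "curv0 a < curv0 b"
  using assms(2) by (rule DERIV_pos_imp_increasing) (use assms(1) curv0_has_positive_derivative in auto)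

lemma a0_root_iff: "a0_root a \<longleftrightarrow> a > 1/15 \<and> curv0 a = - 2 * zeta3"
  by (auto simp: a0_root_def deriv2_Digamma_1 calL_xx_0_eq_curv0)

text \<open>
  The lower end is the delicate one: there \<open>curv0\<close> lies below \<open>- 2 \<zeta>(3)\<close> by only about \<open>10\<^sup>-\<^sup>1\<^sup>6\<close>.
\<close>

lemma curv0_bracket:
  "curv0 (0.4321803644583305 - 1/10^16) < - 2 * zeta3"
  "- 2 * zeta3 < curv0 (0.4321803644583305 + 1/10^16)"
proof -
  have "curv0 (0.4321803644583305 - 1/10^16) < - 2 * (1202056903159594309 / 10^18)"
    by (simp add: curv0_def power2_eq_square power3_eq_cube)
  then show "curv0 (0.4321803644583305 - 1/10^16) < - 2 * zeta3"
    using zeta3_bounds by linarith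
  have "- 2 * (1202056903159594285 / 10^18) < curv0 (0.4321803644583305 + 1/10^16)"
    by (simp add: curv0_def power2_eq_square power3_eq_cube)
  then show "- 2 * zeta3 < curv0 (0.4321803644583305 + 1/10^16)"
    using zeta3_bounds by linarith
qed

lemma a0_root_unique:
  assumes "a0_root a" "a0_root b"
  shows "a = b"
  using assms curv0_strict_mono[of a b] curv0_strict_mono[of b a]
  unfolding a0_root_iff by linarith

lemma ex1_a0_root: "\<exists>!a. a0_root a"
  and a0''_bounds: "\<bar>a0'' - 0.4321803644583305\<bar> < 1 / 10^16"
proof -
  define lo hi :: real where "lo = 0.4321803644583305 - 1/10^16" and "hi = 0.4321803644583305 + 1/10^16"
  have lo: "1/15 < lo" and "lo \<le> hi" by (simp_all add: lo_def hi_def)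
  note br = curv0_bracket[folded lo_def hi_def]
  have "continuous_on {lo..hi} curv0"
    using curv0_has_positive_derivative lo
    by (intro continuous_at_imp_continuous_on) (meson DERIV_isCont atLeastAtMost_iff less_le_trans)
  then obtain r where r: "lo \<le> r" "r \<le> hi" "curv0 r = - 2 * zeta3"
    using IVT'[of curv0 lo "- 2 * zeta3" hi] br \<open>lo \<le> hi\<close> by auto
  then have "lo \<noteq> r" "r \<noteq> hi" using br by auto
  have "a0_root r" using r lo by (auto simp: a0_root_iff)
  then show ex1: "\<exists>!a. a0_root a" using a0_root_unique by blast
  have "a0'' = r"
    unfolding a0''_def using ex1 \<open>a0_root r\<close> by (rule the1_equality)
  then show "\<bar>a0'' - 0.4321803644583305\<bar> < 1 / 10^16"
    using r \<open>lo \<noteq> r\<close> \<open>r \<noteq> hi\<close> unfolding abs_less_iff lo_def hi_def by auto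
qed

section \<open>The increments of l\<close>

text \<open>
  The increment as a function of a real variable; \<open>incr a x\<close> interpolates \<open>l a n - l a (n - 1)\<close>, so
  the increments with \<open>n - 1 \<ge> 1\<close> correspond to \<open>x \<ge> 2\<close>.
\<close>

definition incr :: "real \<Rightarrow> real \<Rightarrow> real" where
  "incr a x = 1 / x
     - 1 / (90*a^2 + 2) * (ln (x^2 + x + (3*a + 1) / 3) - ln (x^2 - x + (3*a + 1) / 3))
     - 45*a^2 / (90*a^2 + 2) *
         (ln (x^2 + x + (15*a - 1) / (45*a)) - ln (x^2 - x + (15*a - 1) / (45*a)))"

lemma l_Suc_diff: "l a (Suc n) - l a n = incr a (real (Suc n))"
proof -
  have "(real (Suc n))^2 - real (Suc n) = (real n)^2 + real n"
    by (simp add: power2_eq_square algebra_simps)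
  then show ?thesis
    by (simp add: l_def incr_def harm_Suc inverse_eq_divide algebra_simps)
qed

lemma incr_tendsto_0: "((\<lambda>x. incr a x) \<longlongrightarrow> 0) at_top"
proof -
  have ln0: "((\<lambda>x. ln (x^2 + x + c) - ln (x^2 - x + c)) \<longlongrightarrow> 0) at_top" for c :: real
    by real_asymp
  have "((\<lambda>x::real. 1 / x) \<longlongrightarrow> 0) at_top" by real_asymp
  then have "((\<lambda>x. incr a x) \<longlongrightarrow> 0 - 1 / (90*a^2 + 2) * 0 - 45*a^2 / (90*a^2 + 2) * 0) at_top"
    unfolding incr_def by (intro tendsto_intros ln0)
  then show ?thesis by simp
qed

text \<open>The numerator of the derivative of \<open>incr a\<close> as a function of \<open>t = x\<^sup>2\<close>.\<close>

definition incr_num :: "real \<Rightarrow> real \<Rightarrow> real" where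
  "incr_num a t = 9*a * (7 + 240*a - 315*a^2) * t - ((3*a + 1) * (15*a - 1))^2"

text \<open>
  A difference of logarithms with shift \<open>c\<close> has derivative \<open>- 2 (t - c) / P t\<close>, where
  \<open>P t = (t + c)\<^sup>2 - t\<close>. Let \<open>Q\<close> be the analogue of \<open>P\<close> for the shift \<open>d\<close>, and let \<open>A\<close>, \<open>B\<close> be the
  weights. The derivative of \<open>incr a\<close> then has the numerator
  \<open>- P Q + 2 A t (t - c) Q + 2 B t (t - d) P\<close> over \<open>t P Q\<close>. Its \<open>t\<^sup>4\<close> coefficient vanishes by
  \<open>2 A + 2 B = 1\<close>, its \<open>t\<^sup>3\<close> coefficient by \<open>2 A c + 2 B d = 1/3\<close>, and its \<open>t\<^sup>2\<close> coefficient by the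
  choice of \<open>c\<close> and \<open>d\<close>.
\<close>

lemma incr_has_derivative:
  assumes a: "a > 1/15" and x: "x \<ge> 2"
  shows "\<exists>K>0. (incr a has_real_derivative incr_num a (x^2) * K) (at x)"
proof -
  define c d where "c = (3*a + 1) / 3" and "d = (15*a - 1) / (45*a)"
  define A B where "A = 1 / (90*a^2 + 2)" and "B = 45*a^2 / (90*a^2 + 2)"
  have cd: "c > 0" "d > 0" and a0: "a > 0" using a by (auto simp: c_def d_def)
  have xx: "x^2 - x \<ge> 0" using x by (simp add: power2_eq_square)
  define p1 p2 q1 q2 where "p1 = x^2 + x + c" and "p2 = x^2 - x + c"
    and "q1 = x^2 + x + d" and "q2 = x^2 - x + d"
  have pos: "p1 > 0" "p2 > 0" "q1 > 0" "q2 > 0"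
    using cd xx x by (auto simp: p1_def p2_def q1_def q2_def intro: add_nonneg_pos)
  have D: "(incr a has_real_derivative
      - 1 / x^2 - A * ((2*x + 1) / p1 - (2*x - 1) / p2) - B * ((2*x + 1) / q1 - (2*x - 1) / q2)) (at x)"
    unfolding incr_def A_def[symmetric] B_def[symmetric] c_def[symmetric] d_def[symmetric]
      p1_def p2_def q1_def q2_def
    using pos x unfolding p1_def p2_def q1_def q2_def
    by (auto intro!: derivative_eq_intros simp: power2_eq_square)
  define r where "r = 45*a^2 + 1"
  have r: "r > 0" by (auto simp: r_def intro: add_nonneg_pos)
  have two_r: "90*a^2 + 2 = 2*r" by (simp add: r_def)
  have AB: "2*A = 1 / r" "2*B = 45*a^2 / r" 
    unfolding A_def B_def two_r by simp_all
  have P: "(2*x + 1) / p1 - (2*x - 1) / p2 = - (2 * (x^2 - c) / (p1 * p2))"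
    using pos by (simp add: field_simps) (simp add: p1_def p2_def algebra_simps power2_eq_square)
  have Q: "(2*x + 1) / q1 - (2*x - 1) / q2 = - (2 * (x^2 - d) / (q1 * q2))"
    using pos by (simp add: field_simps) (simp add: q1_def q2_def algebra_simps power2_eq_square)
  have key: "18225*a^2 * (- (p1*p2*q1*q2) * r + x^2 * ((x^2 - c) * (q1*q2) + 45*a^2*(x^2 - d) * (p1*p2)))
      = r * incr_num a (x^2)"
  proof -
    \<comment> \<open>Clear the denominators of \<open>c\<close> and \<open>d\<close> first: \<open>9 P\<close> and \<open>(45 a)\<^sup>2 Q\<close> are polynomials in \<open>a\<close>
      and \<open>X\<close>, so that the final step is an identity of polynomials in two variables.\<close>
    define X where "X = x^2"
    define P9 Q9 where "P9 = 9*X^2 + (18*a - 3)*X + (3*a + 1)^2"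
      and "Q9 = 2025*a^2*X^2 - (675*a^2 + 90*a)*X + (15*a - 1)^2"
    have c3: "3*c = 3*a + 1" and d45: "45*a*d = 15*a - 1" using a0 by (auto simp: c_def d_def)
    have "9 * (p1*p2) = 9*X^2 + (6*(3*c) - 9)*X + (3*c)^2"
      unfolding p1_def p2_def X_def by algebra
    also have "\<dots> = P9" unfolding P9_def c3 by algebra
    finally have P9: "9 * (p1*p2) = P9" .
    have "2025*a^2 * (q1*q2) = 2025*a^2*X^2 + (90*a*(45*a*d) - 2025*a^2)*X + (45*a*d)^2"
      unfolding q1_def q2_def X_def by algebra
    also have "\<dots> = Q9" unfolding Q9_def d45 by algebra
    finally have Q9: "2025*a^2 * (q1*q2) = Q9" .
    have "18225*a^2 * (- (p1*p2*q1*q2) * r + x^2 * ((x^2 - c) * (q1*q2) + 45*a^2*(x^2 - d) * (p1*p2)))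
      = - (9 * (p1*p2)) * (2025*a^2 * (q1*q2)) * r
        + X * (3*(3*X - 3*c) * (2025*a^2*(q1*q2)) + 2025*a^3*(45*a*X - 45*a*d) * (9*(p1*p2)))"
      unfolding X_def by algebra
    also have "\<dots> = r * incr_num a (x^2)"
      unfolding P9 Q9 c3 d45 unfolding P9_def Q9_def r_def incr_num_def X_def[symmetric] by algebra
    finally show ?thesis .
  qed
  define K where "K = 1 / (18225*a^2 * (x^2 * (p1*p2*q1*q2)))"
  have "K > 0" using pos a0 x by (auto simp: K_def)
  have "- 1 / x^2 - A * ((2*x + 1) / p1 - (2*x - 1) / p2) - B * ((2*x + 1) / q1 - (2*x - 1) / q2)
      = - 1 / x^2 + 2*A * (x^2 - c) / (p1 * p2) + 2*B * (x^2 - d) / (q1 * q2)"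
    unfolding P Q by (simp add: mult_ac)
  also have "\<dots> = (- (p1*p2*q1*q2) * r + x^2 * ((x^2 - c) * (q1*q2) + 45*a^2*(x^2 - d) * (p1*p2)))
       / (r * (x^2 * (p1*p2*q1*q2)))"
    unfolding AB using pos r x by (simp add: field_simps)
  also have "\<dots> = incr_num a (x^2) * K"
  proof -
    have "E / (r * y) = m * (1 / (k * y))" if "k * E = r * m" "k > 0" "y > 0" for E m k y :: real
      using that r by (simp add: field_simps)
    from this[OF key] show ?thesis using pos x a0 by (simp add: K_def)
  qed
  finally show ?thesis using D \<open>K > 0\<close> by auto
qed

lemma incr_num_neg:
  assumes "a \<ge> a1" "t \<ge> 0"
  shows "incr_num a t < 0"
proof -
  have s: "sqrt 205 \<ge> 14" by (rule real_le_rsqrt) simp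
  have "105*a - 40 \<ge> 3 * sqrt 205" using assms by (simp add: a1_def field_simps)
  moreover from this have "(3 * sqrt 205)^2 \<le> (105*a - 40)^2" using s by (intro power_mono) auto
  \<comment> \<open>Completing the square: \<open>35 (315 a\<^sup>2 - 240 a - 7) = (105 a - 40)\<^sup>2 - 1845\<close>.\<close>
  ultimately have "7 + 240*a - 315*a^2 \<le> 0" and a: "a > 1/15"
    using s by (auto simp: power2_eq_square algebra_simps)
  then have "9*a * (7 + 240*a - 315*a^2) * t \<le> 0"
    using assms(2) by (intro mult_nonpos_nonneg mult_nonneg_nonpos) auto
  moreover have "((3*a + 1) * (15*a - 1))^2 > 0" using a by auto
  ultimately show ?thesis unfolding incr_num_def by linarith
qed

text \<open>
  The bound \<open>11/25\<close> is a round number above \<open>a0''\<close>. Below it, \<open>a\<^sup>2 \<le> 11/25 a\<close> reduces the claim to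
  a comparison of quadratic polynomials in \<open>a\<close>.
\<close>

lemma incr_num_pos:
  assumes "1/15 < a" "a < 11/25" "t \<ge> 4"
  shows "incr_num a t > 0"
proof -
  have sq: "a^2 \<le> 11/25 * a" using assms by (simp add: power2_eq_square)
  then have "7 + 240*a - 315*a^2 \<ge> 7 + 101 * a" using assms by simp
  then have "9*a * (7 + 101*a) * 4 \<le> 9*a * (7 + 240*a - 315*a^2) * t"
    using assms by (intro mult_mono) auto
  moreover have "((3*a + 1) * (15*a - 1))^2 < 9*a * (7 + 101*a) * 4"
  proof -
    have "(3*a + 1) * (15*a - 1) = 45*a^2 + 12*a - 1" by (simp add: algebra_simps power2_eq_square)
    also have "\<dots> \<le> 159/5*a" using sq assms by simp
    finally have "((3*a + 1) * (15*a - 1))^2 \<le> (159/5*a)^2" using assms by (intro power_mono) auto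
    also have "\<dots> = 25281/25*a^2" by (simp add: power_mult_distrib power2_eq_square)
    also have "\<dots> < 252*a + 3636*a^2" using assms zero_le_power2[of a] by linarith
    also have "\<dots> = 9*a * (7 + 101*a) * 4" by (simp add: power2_eq_square algebra_simps)
    finally show ?thesis .
  qed
  ultimately show ?thesis unfolding incr_num_def by linarith
qed

section \<open>Monotonicity and convexity\<close>

lemma incr_strict_antimono:
  assumes "a > 1/15" "a \<ge> a1" "2 \<le> x" "x < y"
  shows "incr a y < incr a x"
proof (rule DERIV_neg_imp_decreasing[OF \<open>x < y\<close>])
  fix z assume "x \<le> z" "z \<le> y"
  then obtain K where "K > 0" "(incr a has_real_derivative incr_num a (z^2) * K) (at z)"
    using incr_has_derivative[of a z] assms by auto
  moreover have "incr_num a (z^2) < 0" using assms by (intro incr_num_neg) auto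
  ultimately show "\<exists>y. (incr a has_real_derivative y) (at z) \<and> y < 0"
    by (meson mult_neg_pos)
qed

lemma incr_strict_mono:
  assumes "1/15 < a" "a < 11/25" "2 \<le> x" "x < y"
  shows "incr a x < incr a y"
proof (rule DERIV_pos_imp_increasing[OF \<open>x < y\<close>])
  fix z assume z: "x \<le> z" "z \<le> y"
  then obtain K where "K > 0" "(incr a has_real_derivative incr_num a (z^2) * K) (at z)"
    using incr_has_derivative[of a z] assms by auto
  moreover have "z^2 \<ge> 2^2" using z assms by (intro power_mono) auto
  then have "incr_num a (z^2) > 0" using assms by (intro incr_num_pos) auto
  ultimately show "\<exists>y. (incr a has_real_derivative y) (at z) \<and> y > 0"
    by (meson mult_pos_pos)
qed

lemma strict_antimono_limit_less:
  fixes f :: "real \<Rightarrow> real"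
  assumes "\<And>x y. b \<le> x \<Longrightarrow> x < y \<Longrightarrow> f y < f x" "(f \<longlongrightarrow> L) at_top" "b \<le> x"
  shows "L < f x"
proof -
  have "eventually (\<lambda>y. f y \<le> f (x + 1)) at_top"
    using eventually_gt_at_top[of "x + 1"]
  proof eventually_elim
    fix y assume "x + 1 < y"
    then show "f y \<le> f (x + 1)" using assms(1)[of "x + 1" y] assms(3) by simp
  qed
  then have "L \<le> f (x + 1)" using assms(2) by (intro tendsto_upperbound) auto
  also have "\<dots> < f x" using assms by auto
  finally show ?thesis .
qed

lemma strict_mono_concave:
  assumes "a > 1/15" "a \<ge> a1"
  shows "strict_mono_on {1..} (l a) \<and> concave_seq (l a)"
proof
  have pos: "incr a x > 0" if "x \<ge> 2" for x
    using strict_antimono_limit_less[of 2 "incr a"] incr_strict_antimono[OF assms] incr_tendsto_0 that by blast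
  have "l a n < l a (Suc n)" if "n \<ge> 1" for n
    using l_Suc_diff[of a n] pos[of "real (Suc n)"] that by auto
  then have step: "l a (Suc k) < l a (Suc (Suc k))" for k by simp
  have "l a m < l a n" if "1 \<le> m" "m < n" for m n :: nat
    using lift_Suc_mono_less[of "\<lambda>k. l a (Suc k)" "m - 1" "n - 1", OF step] that by simp
  then show "strict_mono_on {1..} (l a)"
    by (intro strict_mono_onI) auto
  show "concave_seq (l a)" unfolding concave_seq_def
  proof (intro allI impI)
    fix n :: nat assume "n \<ge> 1"
    then have "incr a (real (Suc (Suc n))) < incr a (real (Suc n))"
      using assms by (intro incr_strict_antimono) auto
    then show "l a n + l a (n + 2) \<le> 2 * l a (n + 1)"
      using l_Suc_diff[of a n] l_Suc_diff[of a "Suc n"] by simp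
  qed
qed

lemma antimono_convex:
  assumes "1/15 < a" "a < 11/25"
  shows "antimono_on {1..} (l a) \<and> convex_seq (l a)"
proof
  have "- incr a y < - incr a x" if "2 \<le> x" "x < y" for x y
    using incr_strict_mono[OF assms that] by simp
  moreover have "((\<lambda>x. - incr a x) \<longlongrightarrow> 0) at_top"
    using tendsto_minus[OF incr_tendsto_0[of a]] by simp
  ultimately have neg: "incr a x < 0" if "x \<ge> 2" for x
    using strict_antimono_limit_less[of 2 "\<lambda>x. - incr a x" 0 x] that by auto
  have "l a n \<ge> l a (Suc n)" if "n \<ge> 1" for n
    using l_Suc_diff[of a n] neg[of "real (Suc n)"] that by auto
  then have step: "l a (Suc (Suc k)) \<le> l a (Suc k)" for k by simp
  have "l a n \<le> l a m" if "1 \<le> m" "m \<le> n" for m n :: nat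
    using lift_Suc_antimono_le[of "\<lambda>k. l a (Suc k)" "m - 1" "n - 1", OF step] that by simp
  then show "antimono_on {1..} (l a)"
    by (intro monotone_onI) auto
  show "convex_seq (l a)" unfolding convex_seq_def
  proof (intro allI impI)
    fix n :: nat assume "n \<ge> 1"
    then have "incr a (real (Suc n)) < incr a (real (Suc (Suc n)))"
      using assms by (intro incr_strict_mono) auto
    then show "l a n + l a (n + 2) \<ge> 2 * l a (n + 1)"
      using l_Suc_diff[of a n] l_Suc_diff[of a "Suc n"] by simp
  qed
qed

theorem theorem7:
  shows "(\<exists>!a. a0_root a) \<and> \<bar>a0'' - 0.4321803644583305\<bar> < 1 / 10^16
    \<and> (\<forall>a. 1 / 15 < a \<and> a \<ge> a1 \<longrightarrow> strict_mono_on {1..} (l a) \<and> concave_seq (l a))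
    \<and> (\<forall>a. 1 / 15 < a \<and> a < a0'' \<longrightarrow> antimono_on {1..} (l a) \<and> convex_seq (l a))"
proof -
  have "a0'' < 11/25" using a0''_bounds unfolding abs_less_iff by auto
  then show ?thesis
    using ex1_a0_root a0''_bounds strict_mono_concave antimono_convex by (auto dest: less_trans)
qed

end
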